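(* For every $\alpha>1$ there exist a real-valued potential $V:\mathbb Z^2\to\mathbb R$, a constant $C_\alpha>0$, and a nonzero function $u$ on $\mathbb Z^2$ such that for all $n\in\mathbb Z^2$ $$|u(n)|\le\langle n\rangle^{-\alpha},\qquad |V(n)|\le C_\alpha\langle n\rangle^{-2},$$ and $(\Delta+V)u=0$. In particular, $u\in\ell^2(\mathbb Z^2)$, and hence $0$ is an eigenvalue of $\Delta+V$ on $\ell^2(\mathbb Z^2)$.
   Context: For $n\in\mathbb Z^2$, $|n|=(n_1^2+n_2^2)^{1/2}$ and $\langle n\rangle=(1+|n|^2)^{1/2}$. $\Delta$ is the (uncentered) nearest-neighbor adjacency operator $(\Delta u)(n)=\sum_{j=1}^2\bigl(u(n+e_j)+u(n-e_j)\bigr)$, with $e_1,e_2$ the standard basis vectors, and $V$ acts by multiplication: $(Vu)(n)=V(n)u(n)$. *)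

theory Defs
  imports "HOL-Analysis.Analysis"
begin

type_synonym lattice = "int \<times> int"

definition lattice_norm :: "lattice \<Rightarrow> real" where
  "lattice_norm n = sqrt ((real_of_int (fst n))\<^sup>2 + (real_of_int (snd n))\<^sup>2)"

definition japanese_bracket :: "lattice \<Rightarrow> real" where
  "japanese_bracket n = sqrt (1 + (lattice_norm n)\<^sup>2)"

definition adjacency_op :: "(lattice \<Rightarrow> complex) \<Rightarrow> lattice \<Rightarrow> complex" where
  "adjacency_op u n =
     (u (n + (1, 0)) + u (n - (1, 0))) + (u (n + (0, 1)) + u (n - (0, 1)))"

definition mult_op :: "(lattice \<Rightarrow> real) \<Rightarrow> (lattice \<Rightarrow> complex) \<Rightarrow> lattice \<Rightarrow> complex" where
  "mult_op V u n = complex_of_real (V n) * u n"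

definition schroedinger_op :: "(lattice \<Rightarrow> real) \<Rightarrow> (lattice \<Rightarrow> complex) \<Rightarrow> lattice \<Rightarrow> complex" where
  "schroedinger_op V u n = adjacency_op u n + mult_op V u n"

definition l2_lattice :: "(lattice \<Rightarrow> complex) set" where
  "l2_lattice = {u. (\<lambda>n. (cmod (u n))\<^sup>2) summable_on UNIV}"

text \<open>The operators above are defined on all functions on the lattice. Being an eigenvalue on
  \<open>\<ell>\<^sup>2\<close> therefore includes that the operator restricts to a map from \<open>\<ell>\<^sup>2\<close> to itself.\<close>

definition l2_eigenvalue ::
  "((lattice \<Rightarrow> complex) \<Rightarrow> lattice \<Rightarrow> complex) \<Rightarrow> complex \<Rightarrow> bool" where
  "l2_eigenvalue T z \<longleftrightarrow>
     (\<forall>v \<in> l2_lattice. T v \<in> l2_lattice) \<and>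
     (\<exists>v \<in> l2_lattice. v \<noteq> (\<lambda>_. 0) \<and> T v = (\<lambda>n. z * v n))"

end

theory Submission
  imports Defs
begin

text \<open>Let \<open>u n = (-1)\<^bsup>n\<^sub>2\<^esup> \<langle>n\<rangle>\<^bsup>-\<alpha>\<^esup>\<close>. The sign is constant along \<open>e\<^sub>1\<close> and alternates along
  \<open>e\<^sub>2\<close>, so \<open>\<Delta> u\<close> is, up to that sign, the difference of the second differences of
  \<open>h = \<langle>n\<rangle>\<^bsup>-\<alpha>\<^esup>\<close> in the two coordinate directions; the terms \<open>\<plusminus>2 h n\<close> cancel. Each second
  difference is \<open>O(h n \<langle>n\<rangle>\<^bsup>-2\<^esup>)\<close> by Taylor's formula, and since \<open>u\<close> has no zeros the equation
  \<open>(\<Delta> + V) u = 0\<close> can be solved for \<open>V\<close>.\<close>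

section \<open>Second differences of negative powers of the bracket\<close>

text \<open>Taylor expansion at 1 with Lagrange remainder
  \<open>b * (b + 1) / 2 * t powr (-b - 2) * (s - 1)^2\<close>. Since \<open>t\<close> lies between
  \<open>s\<close> and 1, the bound \<open>s \<ge> 1/3\<close> keeps it away from the singularity at
  0 and yields the factor \<open>3 powr (b + 2)\<close>.\<close>

lemma powr_minus_Taylor2:
  fixes s b :: real
  assumes "b > 0" "s \<ge> 1/3"
  shows "\<bar>s powr (-b) - 1 + b * (s - 1)\<bar> \<le> b * (b + 1) / 2 * 3 powr (b + 2) * (s - 1)\<^sup>2"
proof (cases "s = 1")
  case False
  define D where "D = (\<lambda>m::nat. \<lambda>t::real. if m = 0 then t powr (-b)
     else if m = 1 then - b * t powr (-b - 1) else b * (b + 1) * t powr (-b - 2))"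
  have der: "\<forall>m t. m < 2 \<and> 1/3 \<le> t \<and> t \<le> max s 1 \<longrightarrow> DERIV (D m) t :> D (Suc m) t"
  proof (intro allI impI)
    fix m :: nat and t :: real
    assume "m < 2 \<and> 1/3 \<le> t \<and> t \<le> max s 1"
    then have t: "t > 0" and m01: "m = 0 \<or> m = 1" by auto
    from m01 show "DERIV (D m) t :> D (Suc m) t"
    proof
      assume "m = 0"
      with t show ?thesis
        by (auto simp: D_def intro!: derivative_eq_intros)
    next
      assume m: "m = 1"
      have "((\<lambda>t. - b * t powr (-b - 1)) has_real_derivative b * (b + 1) * t powr (-b - 2)) (at t)"
        using t by (auto intro!: derivative_eq_intros simp: algebra_simps)
      with m show ?thesis by (simp add: D_def)
    qed
  qed
  obtain t where t: "if s < 1 then s < t \<and> t < 1 else 1 < t \<and> t < s"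
    and eq: "s powr (-b) = (\<Sum>m<2. D m 1 / fact m * (s - 1) ^ m) + D 2 t / fact 2 * (s - 1) ^ 2"
    using Taylor[of 2 D "\<lambda>t. t powr (-b)" "1/3" "max s 1" 1 s] der assms False
    by (auto simp: D_def)
  have t3: "t \<ge> 1/3" using t assms by (auto split: if_splits)
  have eq': "s powr (-b) - 1 + b * (s - 1) = b * (b + 1) / 2 * t powr (-b - 2) * (s - 1)\<^sup>2"
    unfolding eq by (simp add: D_def numeral_2_eq_2 field_simps)
  have "t powr (-b - 2) \<le> (1/3) powr (-b - 2)"
    using t3 assms by (intro powr_mono2') auto
  also have "\<dots> = 3 powr (b + 2)"
    by (simp add: powr_divide powr_minus_divide[symmetric] powr_minus)
       (simp add: powr_diff powr_add powr_minus field_simps)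
  finally have "b * (b + 1) / 2 * t powr (-b - 2) * (s - 1)\<^sup>2
      \<le> b * (b + 1) / 2 * 3 powr (b + 2) * (s - 1)\<^sup>2"
    using assms by (intro mult_right_mono mult_left_mono) auto
  then show ?thesis unfolding eq' using assms by simp
qed simp

text \<open>Dividing by the central value reduces the claim to expanding \<open>s powr (-b)\<close>
  near 1 at the two ratios \<open>s 1\<close> and \<open>s (-1)\<close>. Their first-order terms
  \<open>2 * x / R\<close> and \<open>- 2 * x / R\<close> cancel, leaving \<open>2 * b / R\<close>;
  each remainder contributes at most \<open>8 * K / R\<close>.\<close>

lemma second_difference_bound:
  fixes x y b K :: real
  assumes b: "b > 0"
  defines "K \<equiv> b * (b + 1) / 2 * 3 powr (b + 2)"
  shows "\<bar>(1 + (x + 1)\<^sup>2 + y\<^sup>2) powr (-b) + (1 + (x - 1)\<^sup>2 + y\<^sup>2) powr (-b) - 2 * (1 + x\<^sup>2 + y\<^sup>2) powr (-b)\<bar>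
    \<le> (2 * b + 16 * K) * (1 + x\<^sup>2 + y\<^sup>2) powr (-b) / (1 + x\<^sup>2 + y\<^sup>2)"
proof -
  define R where "R = 1 + x\<^sup>2 + y\<^sup>2"
  have R: "R > 0" unfolding R_def by (simp add: add_pos_nonneg)
  have K: "K > 0" using b by (simp add: K_def)
  define s where "s = (\<lambda>e. (1 + (x + e)\<^sup>2 + y\<^sup>2) / R)"
  have T: "\<bar>s e powr (-b) - 1 + b * (s e - 1)\<bar> \<le> 8 * K / R" if "e = 1 \<or> e = -1" for e :: real
  proof -
    \<comment> \<open>For \<open>e^2 = 1\<close>, twice the difference of the two sides of the next
      inequality is this expression plus 1.\<close>
    have "0 \<le> (2 * x + 3 * e)\<^sup>2 + 4 * y\<^sup>2" by simp
    then have "R \<le> 3 * (1 + (x + e)\<^sup>2 + y\<^sup>2)"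
      using that unfolding R_def by (auto simp: power2_eq_square algebra_simps)
    then have "s e \<ge> 1/3" using R by (simp add: s_def field_simps)
    then have 1: "\<bar>s e powr (-b) - 1 + b * (s e - 1)\<bar> \<le> K * (s e - 1)\<^sup>2"
      unfolding K_def by (rule powr_minus_Taylor2[OF b])
    have se: "s e - 1 = (1 + 2 * e * x) / R"
      using R that by (auto simp: s_def R_def power2_eq_square field_simps)
    \<comment> \<open>The right-hand side equals \<open>8 * R - (1 + 2 * e * x)^2\<close>, which is
      the source of the constant 8.\<close>
    have "0 \<le> (1 - 2 * e * x)\<^sup>2 + 6 + 8 * y\<^sup>2" by simp
    then have "(1 + 2 * e * x)\<^sup>2 \<le> 8 * R"
      using that unfolding R_def by (auto simp: power2_eq_square algebra_simps)
    then have "(s e - 1)\<^sup>2 \<le> 8 * R / R\<^sup>2"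
      unfolding se power_divide using R by (intro divide_right_mono) auto
    also have "\<dots> = 8 / R" using R by (simp add: power2_eq_square)
    finally have "(s e - 1)\<^sup>2 \<le> 8 / R" .
    then have "K * (s e - 1)\<^sup>2 \<le> K * (8 / R)"
      using K by (intro mult_left_mono) auto
    with 1 show ?thesis by (simp add: mult.commute)
  qed
  have sum2: "s 1 + s (-1) = 2 + 2 / R"
  proof -
    have "s 1 + s (-1) = (2 * R + 2) / R"
      unfolding s_def add_divide_distrib[symmetric]
      by (rule arg_cong[where f = "\<lambda>z. z / R"]) (simp add: R_def power2_eq_square algebra_simps)
    also have "\<dots> = 2 + 2 / R" using R by (simp add: field_simps)
    finally show ?thesis .
  qed
  have "s 1 powr (-b) + s (-1) powr (-b) - 2 =
      (s 1 powr (-b) - 1 + b * (s 1 - 1)) + (s (-1) powr (-b) - 1 + b * (s (-1) - 1))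
      - b * (s 1 + s (-1) - 2)"
    by (simp add: algebra_simps)
  also have "\<dots> = (s 1 powr (-b) - 1 + b * (s 1 - 1)) + (s (-1) powr (-b) - 1 + b * (s (-1) - 1))
      - 2 * b / R"
    unfolding sum2 by simp
  finally have split: "s 1 powr (-b) + s (-1) powr (-b) - 2 =
      (s 1 powr (-b) - 1 + b * (s 1 - 1)) + (s (-1) powr (-b) - 1 + b * (s (-1) - 1)) - 2 * b / R" .
  have "\<bar>s 1 powr (-b) + s (-1) powr (-b) - 2\<bar> \<le> 8 * K / R + 8 * K / R + 2 * b / R"
  proof -
    have "\<bar>A + B - d\<bar> \<le> k + k + d" if "\<bar>A\<bar> \<le> k" "\<bar>B\<bar> \<le> k" "0 \<le> d" for A B d k :: real
      using that by linarith
    from this[OF T T, of 1 "-1" "2 * b / R"] b R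
    show "\<bar>s 1 powr (-b) + s (-1) powr (-b) - 2\<bar> \<le> 8 * K / R + 8 * K / R + 2 * b / R"
      unfolding split by simp
  qed
  also have "\<dots> = (2 * b + 16 * K) / R"
    using R by (simp add: field_simps)
  finally have bd: "\<bar>s 1 powr (-b) + s (-1) powr (-b) - 2\<bar> \<le> (2 * b + 16 * K) / R" .
  \<comment> \<open>Multiplicativity of the power undoes the normalization by
    \<open>R\<close>.\<close>
  have spl: "(1 + (x + e)\<^sup>2 + y\<^sup>2) powr (-b) = R powr (-b) * s e powr (-b)" for e
  proof -
    have "1 + (x + e)\<^sup>2 + y\<^sup>2 = R * s e" using R by (simp add: s_def)
    moreover have "s e \<ge> 0" using R by (simp add: s_def)
    ultimately show ?thesis using R by (simp add: powr_mult)
  qed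
  have "(1 + (x + 1)\<^sup>2 + y\<^sup>2) powr (-b) + (1 + (x - 1)\<^sup>2 + y\<^sup>2) powr (-b) - 2 * R powr (-b)
      = R powr (-b) * (s 1 powr (-b) + s (-1) powr (-b) - 2)"
    using spl[of 1] spl[of "-1"] by (simp add: algebra_simps)
  then have "\<bar>(1 + (x + 1)\<^sup>2 + y\<^sup>2) powr (-b) + (1 + (x - 1)\<^sup>2 + y\<^sup>2) powr (-b) - 2 * R powr (-b)\<bar>
      \<le> R powr (-b) * ((2 * b + 16 * K) / R)"
    using mult_left_mono[OF bd, of "R powr (-b)"] by (simp add: abs_mult)
  then show ?thesis by (simp add: R_def mult.commute)
qed

section \<open>Summability of powers of the bracket\<close>

text \<open>Removing the square root halves the exponent, so decay of order \<alpha> corresponds to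
  \<open>b = \<alpha> / 2\<close> in the second-difference estimate.\<close>

lemma japanese_bracket_powr:
  "japanese_bracket n powr a
     = (1 + (real_of_int (fst n))\<^sup>2 + (real_of_int (snd n))\<^sup>2) powr (a / 2)"
proof -
  have "japanese_bracket n = sqrt (1 + (real_of_int (fst n))\<^sup>2 + (real_of_int (snd n))\<^sup>2)"
    by (simp add: japanese_bracket_def lattice_norm_def add.assoc)
  then show ?thesis
    by (simp add: powr_half_sqrt[symmetric] powr_powr)
qed

lemma summable_on_int_powr:
  fixes a :: real
  assumes "a > 1"
  shows "(\<lambda>k::int. (1 + (real_of_int k)\<^sup>2) powr (- (a / 2))) summable_on UNIV"
proof -
  let ?f = "\<lambda>k::int. (1 + (real_of_int k)\<^sup>2) powr (- (a / 2))"
  have nat: "(\<lambda>k::nat. ?f (int k)) summable_on UNIV"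
  proof -
    \<comment> \<open>At \<open>k = 0\<close> the comparison fails: the left side is 1, while
      \<open>0 powr (-a)\<close> is 0.\<close>
    have bd: "?f (int k) \<le> real k powr (-a)" if "k \<ge> 1" for k
    proof -
      have "?f (int k) \<le> ((real k)\<^sup>2) powr (- (a / 2))"
        using that assms by (intro powr_mono2') auto
      also have "\<dots> = real k powr (-a)"
        using that by (simp add: powr_numeral[symmetric] powr_powr del: powr_numeral)
      finally show ?thesis .
    qed
    have "summable (\<lambda>k. ?f (int k))"
    proof (rule summable_comparison_test)
      show "\<exists>N. \<forall>k\<ge>N. norm (?f (int k)) \<le> real k powr (-a)"
        using bd by (intro exI[of _ 1]) auto
      show "summable (\<lambda>k. real k powr (-a))"
        using assms by (simp add: summable_real_powr_iff)
    qed
    then show ?thesis by (simp add: summable_on_UNIV_nonneg_real_iff)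
  qed
  have 1: "?f summable_on (range int)"
    using nat by (subst summable_on_reindex) (auto simp: o_def)
  have 2: "?f summable_on (range (\<lambda>k. - int k))"
    using nat by (subst summable_on_reindex) (auto simp: o_def inj_def)
  \<comment> \<open>The set difference removes the shared point 0, making the union
    disjoint.\<close>
  have "?f summable_on (range int \<union> (range (\<lambda>k. - int k) - range int))"
    by (rule summable_on_Un_disjoint[OF 1 summable_on_subset_banach[OF 2]]) auto
  moreover have "range int \<union> (range (\<lambda>k. - int k) - range int) = UNIV"
    by (auto simp: image_iff) (metis int_cases2)
  ultimately show ?thesis by simp
qed

text \<open>With \<open>p\<close>, \<open>q\<close> the squared coordinates,
  \<open>(1 + p) * (1 + q) \<le> (1 + p + q)^2\<close>. Hence the summand is dominated by a product
  of two one-dimensional summands, each summable for \<open>a > 1\<close>.\<close>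

lemma summable_on_japanese_bracket:
  assumes "a > 1"
  shows "(\<lambda>n. japanese_bracket n powr (- (2 * a))) summable_on UNIV"
proof -
  let ?f = "\<lambda>k::int. (1 + (real_of_int k)\<^sup>2) powr (- (a / 2))"
  have f: "?f summable_on UNIV" by (rule summable_on_int_powr[OF assms])
  have "(\<lambda>(x, y). ?f x * ?f y) summable_on (SIGMA x:UNIV. UNIV)"
  proof (rule summable_on_SigmaI)
    show "((\<lambda>y. case (x, y) of (x, y) \<Rightarrow> ?f x * ?f y) has_sum ?f x * infsum ?f UNIV) UNIV" for x
      using has_sum_cmult_right[OF has_sum_infsum[OF f]] by simp
    show "(\<lambda>x. ?f x * infsum ?f UNIV) summable_on UNIV"
      by (rule summable_on_cmult_left[OF f])
  qed auto
  then have "(\<lambda>(x, y). ?f x * ?f y) summable_on UNIV" by simp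
  then show ?thesis
  proof (rule summable_on_comparison_test)
    fix n :: lattice
    define p q where "p = (real_of_int (fst n))\<^sup>2" and "q = (real_of_int (snd n))\<^sup>2"
    have pq: "p \<ge> 0" "q \<ge> 0" by (auto simp: p_def q_def)
    have "0 \<le> p + q + p\<^sup>2 + q\<^sup>2 + p * q" using pq by simp
    then have "(1 + p) * (1 + q) \<le> (1 + p + q)\<^sup>2"
      by (simp add: power2_eq_square algebra_simps)
    then have "((1 + p + q)\<^sup>2) powr (- (a / 2)) \<le> ((1 + p) * (1 + q)) powr (- (a / 2))"
      using pq assms by (intro powr_mono2') (auto intro: add_pos_nonneg)
    moreover have "((1 + p + q)\<^sup>2) powr (- (a / 2)) = (1 + p + q) powr (-a)"
      using pq by (simp add: powr_numeral[symmetric] powr_powr del: powr_numeral)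
    ultimately show "japanese_bracket n powr (- (2 * a)) \<le> (case n of (x, y) \<Rightarrow> ?f x * ?f y)"
      using pq unfolding japanese_bracket_powr
      by (simp add: p_def q_def powr_mult split_beta)
  qed simp
qed

section \<open>Invariance of the square-summable functions\<close>

lemma l2_lattice_add:
  assumes "v \<in> l2_lattice" "w \<in> l2_lattice"
  shows "(\<lambda>n. v n + w n) \<in> l2_lattice"
proof -
  have "(\<lambda>n. 2 * (cmod (v n))\<^sup>2 + 2 * (cmod (w n))\<^sup>2) summable_on UNIV"
    using assms by (intro summable_on_add summable_on_cmult_right) (auto simp: l2_lattice_def)
  moreover have "(cmod (v n + w n))\<^sup>2 \<le> 2 * (cmod (v n))\<^sup>2 + 2 * (cmod (w n))\<^sup>2" for n
  proof -
    have "(cmod (v n + w n))\<^sup>2 \<le> (cmod (v n) + cmod (w n))\<^sup>2"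
      by (intro power_mono norm_triangle_ineq) auto
    also have "\<dots> \<le> 2 * (cmod (v n))\<^sup>2 + 2 * (cmod (w n))\<^sup>2"
      using zero_le_power2[of "cmod (v n) - cmod (w n)"]
      by (simp add: power2_eq_square algebra_simps)
    finally show ?thesis .
  qed
  ultimately show ?thesis
    unfolding l2_lattice_def by (auto intro: summable_on_comparison_test)
qed

lemma l2_lattice_shift:
  assumes "v \<in> l2_lattice"
  shows "(\<lambda>n. v (n + k)) \<in> l2_lattice"
proof -
  have "bij_betw (\<lambda>n. n + k) (UNIV :: lattice set) UNIV"
    by (rule bij_betwI[where g = "\<lambda>n. n - k"]) auto
  from summable_on_reindex_bij_betw[OF this, of "\<lambda>n. (cmod (v n))\<^sup>2"] assms
  show ?thesis by (simp add: l2_lattice_def)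
qed

lemma l2_lattice_mult_op:
  assumes "v \<in> l2_lattice" "\<And>n. \<bar>V n\<bar> \<le> B"
  shows "mult_op V v \<in> l2_lattice"
proof -
  have "(\<lambda>n. B\<^sup>2 * (cmod (v n))\<^sup>2) summable_on UNIV"
    using assms(1) by (intro summable_on_cmult_right) (simp add: l2_lattice_def)
  moreover have "(cmod (mult_op V v n))\<^sup>2 \<le> B\<^sup>2 * (cmod (v n))\<^sup>2" for n
  proof -
    have "(V n)\<^sup>2 \<le> B\<^sup>2"
      using power_mono[OF assms(2)[of n] abs_ge_zero, of 2] by simp
    then show ?thesis
      by (simp add: mult_op_def norm_mult power_mult_distrib mult_right_mono)
  qed
  ultimately show ?thesis
    unfolding l2_lattice_def by (auto intro: summable_on_comparison_test)
qed

text \<open>Supplies the invariance clause of \<open>l2_eigenvalue\<close>: the operator is a sum of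
  four shifts and multiplication by a bounded function.\<close>

lemma l2_lattice_schroedinger_op:
  assumes "v \<in> l2_lattice" "\<And>n. \<bar>V n\<bar> \<le> B"
  shows "schroedinger_op V v \<in> l2_lattice"
proof -
  have minus: "(\<lambda>n. v (n - k)) \<in> l2_lattice" for k
    using l2_lattice_shift[OF assms(1), of "-k"] by simp
  show ?thesis
    unfolding schroedinger_op_def[abs_def] adjacency_op_def
    by (intro l2_lattice_add l2_lattice_shift minus l2_lattice_mult_op[OF assms] assms(1))
qed

theorem theorem2:
  fixes \<alpha> :: real
  assumes "\<alpha> > 1"
  shows "\<exists>(V :: lattice \<Rightarrow> real) (C :: real) (u :: lattice \<Rightarrow> complex).
           C > 0 \<and> u \<noteq> (\<lambda>_. 0) \<and>
           (\<forall>n. cmod (u n) \<le> japanese_bracket n powr (- \<alpha>) \<and>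
                \<bar>V n\<bar> \<le> C * japanese_bracket n powr (- 2)) \<and>
           schroedinger_op V u = (\<lambda>_. 0) \<and>
           u \<in> l2_lattice \<and>
           l2_eigenvalue (schroedinger_op V) 0"
proof -
  define h where "h = (\<lambda>n. japanese_bracket n powr (- \<alpha>))"
  define R where "R = (\<lambda>n::lattice. 1 + (real_of_int (fst n))\<^sup>2 + (real_of_int (snd n))\<^sup>2)"
  \<comment> \<open>This is \<open>2 * b + 16 * K\<close> from
    \<open>second_difference_bound\<close> at \<open>b = \<alpha> / 2\<close>.\<close>
  define c where "c = \<alpha> + 16 * (\<alpha> / 2 * (\<alpha> / 2 + 1) / 2 * 3 powr (\<alpha> / 2 + 2))"
  define V where "V = (\<lambda>n. - (h (n + (1, 0)) + h (n - (1, 0)) - h (n + (0, 1)) - h (n - (0, 1))) / h n)"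
  define \<sigma> where "\<sigma> = (\<lambda>n::lattice. if even (snd n) then 1 else -1 :: real)"
  define u where "u = (\<lambda>n. complex_of_real (\<sigma> n * h n))"
  have R1: "R n \<ge> 1" for n by (simp add: R_def)
  have h: "h n = R n powr (- (\<alpha> / 2))" for n
    by (simp add: h_def R_def japanese_bracket_powr)
  have h_pos: "h n > 0" for n using R1[of n] by (simp add: h)
  have c: "c > 0" unfolding c_def using assms by (intro add_pos_nonneg) auto
  have d1: "\<bar>h (n + (1, 0)) + h (n - (1, 0)) - 2 * h n\<bar> \<le> c * h n / R n" for n
    using second_difference_bound[of "\<alpha> / 2" "real_of_int (fst n)" "real_of_int (snd n)"] assms
    by (simp add: h R_def c_def)
  \<comment> \<open>The same estimate with the coordinates exchanged, as \<open>R\<close> is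
    symmetric in them.\<close>
  have d2: "\<bar>h (n + (0, 1)) + h (n - (0, 1)) - 2 * h n\<bar> \<le> c * h n / R n" for n
    using second_difference_bound[of "\<alpha> / 2" "real_of_int (snd n)" "real_of_int (fst n)"] assms
    by (simp add: h R_def c_def add_ac)
  have V_le: "\<bar>V n\<bar> \<le> 2 * c / R n" for n
  proof -
    have "\<bar>h (n + (1, 0)) + h (n - (1, 0)) - h (n + (0, 1)) - h (n - (0, 1))\<bar> \<le> 2 * (c * h n / R n)"
      using d1[of n] d2[of n] by linarith
    then show ?thesis using h_pos[of n]
      by (simp add: V_def abs_divide pos_divide_le_eq abs_minus_commute field_simps)
  qed
  have V_bracket: "\<bar>V n\<bar> \<le> 2 * c * japanese_bracket n powr (- 2)" for n
    using V_le[of n] R1[of n] by (simp add: japanese_bracket_powr R_def powr_minus_divide)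
  have V_bdd: "\<bar>V n\<bar> \<le> 2 * c" for n
  proof -
    have "2 * c / R n \<le> 2 * c" using R1[of n] c by (simp add: pos_divide_le_eq)
    with V_le[of n] show ?thesis by linarith
  qed
  have u_norm: "cmod (u n) = h n" for n
    using h_pos[of n] by (simp add: u_def \<sigma>_def)
  have u_nz: "u \<noteq> (\<lambda>_. 0)"
    using u_norm[of 0] h_pos[of 0] by auto
  have u_eq: "schroedinger_op V u = (\<lambda>_. 0)"
  proof
    fix n
    have sg: "\<sigma> (n + (1, 0)) = \<sigma> n" "\<sigma> (n - (1, 0)) = \<sigma> n"
      "\<sigma> (n + (0, 1)) = - \<sigma> n" "\<sigma> (n - (0, 1)) = - \<sigma> n"
      by (auto simp: \<sigma>_def)
    have Vh: "V n * h n = - (h (n + (1, 0)) + h (n - (1, 0)) - h (n + (0, 1)) - h (n - (0, 1)))"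
      using h_pos[of n] by (simp add: V_def)
    have "schroedinger_op V u n = complex_of_real (\<sigma> n *
        (h (n + (1, 0)) + h (n - (1, 0)) - h (n + (0, 1)) - h (n - (0, 1)) + V n * h n))"
      by (simp add: schroedinger_op_def adjacency_op_def mult_op_def u_def sg algebra_simps)
    then show "schroedinger_op V u n = 0" by (simp add: Vh)
  qed
  \<comment> \<open>Squaring doubles the exponent, so the two-dimensional summability lemma applies
    with \<open>a = \<alpha>\<close>, using \<alpha> > 1.\<close>
  have "(cmod (u n))\<^sup>2 = japanese_bracket n powr (- (2 * \<alpha>))" for n
    by (simp add: u_norm h_def power2_eq_square powr_add[symmetric])
  then have u_l2: "u \<in> l2_lattice"
    using summable_on_japanese_bracket[OF assms] by (simp add: l2_lattice_def)
  have "l2_eigenvalue (schroedinger_op V) 0"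
    unfolding l2_eigenvalue_def
    using l2_lattice_schroedinger_op[of _ V "2 * c", OF _ V_bdd] u_l2 u_nz u_eq by auto
  moreover have "2 * c > 0" using c by simp
  moreover have "cmod (u n) \<le> japanese_bracket n powr (- \<alpha>)" for n
    by (simp add: u_norm h_def)
  ultimately show ?thesis using u_nz u_eq u_l2 V_bracket by blast
qed

end
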